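(* Let $m,w,c,d$, the B-spline scaling function $\phi$, the spline wavelet $\psi$ of order $m$ with $\operatorname{supp}\psi=[0,w]$, and the spaces $V_j\subset L^2[c,d]$ be as described in the context. Let $j\ge 0$ and $\ell\ge 1$ be integers, and define the set of functions on $[c,d]$ $$\mathcal{W}_{j,\ell}:=\left\{\psi_{j,k_\ell}\big|_{[c,d]} \;:\; k_\ell\in (2^jc-w,\,2^jd)\cap \tfrac{1}{2^{\ell}}\mathbb{Z}\right\},\qquad \psi_{j,k_\ell}(x)=2^{j/2}\psi(2^jx-k_\ell).$$ Then $$\operatorname{span}\{\mathcal{W}_{j,\ell}\}=V_{j+\ell}.$$
   Context: Fix a positive integer $m$ (the spline order) and integers $c<d$. All functions on $[c,d]$ are regarded as elements of $L^2[c,d]$, and $\operatorname{span}$ denotes the set of finite linear combinations. Scaling function. Let $\phi$ be the cardinal B-spline of order $m$ associated with the uniform simple knots $0,1,\dots,m$, $$\phi(x)=\frac{1}{m!}\sum_{i=0}^m(-1)^i\binom{m}{i}(x-i)^{m-1}_+,$$ where $(x-i)_+^{m-1}$ equals $(x-i)^{m-1}$ if $x-i>0$ and $0$ otherwise. Its support is $[0,m]$. For an integer $j\ge 0$ and $k\in\mathbb{Z}$ put $\phi_{j,k}(x)=2^{j/2}\phi(2^jx-k)$. Spline spaces. For an integer $j\ge 0$, $$V_j=\operatorname{span}\{\phi_{j,k}|_{[c,d]} : k\in(2^jc-m,\,2^jd)\cap\mathbb{Z}\}\subset L^2[c,d].$$ This is the cardinal spline space of order $m$ on $[c,d]$ with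 simple knots at the equidistant partition of $[c,d]$ with distance $2^{-j}$ between adjacent knots (piecewise polynomials of order $m$, i.e. of degree at most $m-1$, with $m-2$ continuous derivatives). One has $V_0\subset V_1\subset\cdots$. Wavelet. $\psi$ is a compactly supported spline wavelet of order $m$ associated with $\phi$: it is a nonzero finite linear combination on $\mathbb{R}$ of the functions $\phi(2x-n)$, $n\in\mathbb{Z}$, with $\operatorname{supp}\psi=[0,w]$, where $w$ is a positive integer. With $\psi_{j,k}(x)=2^{j/2}\psi(2^jx-k)$ and $z=(w-1)/2$, the wavelet spaces $$W_j=\operatorname{span}\{\psi_{j,k}|_{[c,d]} : k\in[2^jc-\lfloor z\rfloor,\,2^jd-\lfloor z\rfloor)\cap\mathbb{Z}\}$$ are complementary subspaces satisfying $V_{j+1}=V_j\oplus W_j$ (direct sum, not necessarily orthogonal) for all integers $j\ge0$, with $\dim W_j=(d-c)2^j$. It is assumed that $d-c\ge\max\{m,w\}$. The same formula $\psi_{j,k_\ell}(x)=2^{j/2}\psi(2^jx-k_\ell)$ is used for non-integer translation parameters $k_\ell\in\frac{1}{2^\ell}\mathbb{Z}=\{p/2^\ell : p\in\mathbb{Z}\}$. *)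

theory Defs
  imports "HOL-Analysis.Analysis"
begin

definition square_integrable :: "(real \<Rightarrow> real) \<Rightarrow> bool" where
  "square_integrable f \<longleftrightarrow> f \<in> borel_measurable lborel \<and> integrable lborel (\<lambda>x. (f x)\<^sup>2)"

definition L2_rel :: "(real \<Rightarrow> real) \<Rightarrow> (real \<Rightarrow> real) \<Rightarrow> bool" where
  "L2_rel f g \<longleftrightarrow> square_integrable f \<and> square_integrable g \<and> (AE x in lborel. f x = g x)"

lemma square_integrable_zero: "square_integrable (\<lambda>x. 0)"
  by (simp add: square_integrable_def)

lemma square_integrable_scale:
  "square_integrable f \<Longrightarrow> square_integrable (\<lambda>x. r * f x)"
  by (auto simp: square_integrable_def power_mult_distrib)

lemma square_integrable_add:
  assumes "square_integrable f" "square_integrable g"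
  shows "square_integrable (\<lambda>x. f x + g x)"
proof -
  have [measurable]: "f \<in> borel_measurable lborel" "g \<in> borel_measurable lborel"
    using assms by (auto simp: square_integrable_def)
  have "integrable lborel (\<lambda>x. 2 * ((f x)\<^sup>2 + (g x)\<^sup>2))"
    using assms by (auto simp: square_integrable_def)
  then have "integrable lborel (\<lambda>x. (f x + g x)\<^sup>2)"
  proof (rule Bochner_Integration.integrable_bound)
    show "AE x in lborel. norm ((f x + g x)\<^sup>2) \<le> norm (2 * ((f x)\<^sup>2 + (g x)\<^sup>2))"
    proof (rule AE_I2)
      fix x
      have "0 \<le> (f x - g x)\<^sup>2" by simp
      then have "(f x + g x)\<^sup>2 \<le> 2 * ((f x)\<^sup>2 + (g x)\<^sup>2)"
        by (simp add: power2_sum power2_diff)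
      then show "norm ((f x + g x)\<^sup>2) \<le> norm (2 * ((f x)\<^sup>2 + (g x)\<^sup>2))"
        by simp
    qed
  qed simp
  then show ?thesis by (simp add: square_integrable_def)
qed

quotient_type L2 = "real \<Rightarrow> real" / partial: L2_rel
proof (rule part_equivpI)
  show "\<exists>f. L2_rel f f"
    by (rule exI[of _ "\<lambda>x. 0"]) (simp add: L2_rel_def square_integrable_zero)
  show "symp L2_rel"
    by (rule sympI) (auto simp: L2_rel_def)
  show "transp L2_rel"
    by (rule transpI) (auto simp: L2_rel_def)
qed

instantiation L2 :: real_vector
begin

lift_definition zero_L2 :: L2 is "\<lambda>x. 0"
  by (simp add: L2_rel_def square_integrable_zero)

lift_definition plus_L2 :: "L2 \<Rightarrow> L2 \<Rightarrow> L2" is "\<lambda>f g x. f x + g x"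
  by (auto simp: L2_rel_def intro: square_integrable_add)

lift_definition scaleR_L2 :: "real \<Rightarrow> L2 \<Rightarrow> L2" is "\<lambda>r f x. r * f x"
  by (auto simp: L2_rel_def intro: square_integrable_scale)

definition uminus_L2 :: "L2 \<Rightarrow> L2" where
  "uminus_L2 u = (- 1) *\<^sub>R u"

definition minus_L2 :: "L2 \<Rightarrow> L2 \<Rightarrow> L2" where
  "minus_L2 u v = u + - v"

instance
proof
  fix u v t :: L2 and r s :: real
  show "u + v + t = u + (v + t)"
    by transfer (auto simp: L2_rel_def add.assoc intro!: square_integrable_add)
  show "u + v = v + u"
    by transfer (auto simp: L2_rel_def add.commute intro!: square_integrable_add)
  show "0 + u = u"
    by transfer (auto simp: L2_rel_def)
  show "- u + u = 0"
    unfolding uminus_L2_def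
    by transfer (auto simp: L2_rel_def square_integrable_zero)
  show "u - v = u + - v"
    by (rule minus_L2_def)
  show "r *\<^sub>R (u + v) = r *\<^sub>R u + r *\<^sub>R v"
    by transfer (auto simp: L2_rel_def algebra_simps
        intro!: square_integrable_add square_integrable_scale)
  show "(r + s) *\<^sub>R u = r *\<^sub>R u + s *\<^sub>R u"
    by transfer (auto simp: L2_rel_def ring_distribs
        intro!: square_integrable_add square_integrable_scale)
  show "r *\<^sub>R s *\<^sub>R u = (r * s) *\<^sub>R u"
    by transfer (auto simp: L2_rel_def mult.assoc intro!: square_integrable_scale)
  show "1 *\<^sub>R u = u"
    by transfer (auto simp: L2_rel_def)
qed

end

text \<open>
  The space \<open>L\<^sup>2[c,d]\<close> is identified, by extension by zero, with the subspace of those elements of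
  \<open>L\<^sup>2(\<real>)\<close> that vanish almost everywhere outside \<open>[c,d]\<close>. Accordingly \<open>L2_restrict c d f\<close> is the
  class of the restriction of \<open>f\<close> to \<open>[c,d]\<close>. It is meaningful only if that restriction is
  square-integrable, which is the case for all splines below.
\<close>

definition L2_restrict :: "int \<Rightarrow> int \<Rightarrow> (real \<Rightarrow> real) \<Rightarrow> L2" where
  "L2_restrict c d f = abs_L2 (\<lambda>x. indicator {real_of_int c..real_of_int d} x * f x)"

lemma L2_restrict_eq_iff:
  assumes f: "square_integrable (\<lambda>x. indicator {real_of_int c..real_of_int d} x * f x)"
    and g: "square_integrable (\<lambda>x. indicator {real_of_int c..real_of_int d} x * g x)"
  shows "L2_restrict c d f = L2_restrict c d g \<longleftrightarrow>
    (AE x in lborel. x \<in> {real_of_int c..real_of_int d} \<longrightarrow> f x = g x)"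
proof -
  have "L2_restrict c d f = L2_restrict c d g \<longleftrightarrow>
      (AE x in lborel. indicator {real_of_int c..real_of_int d} x * f x
        = indicator {real_of_int c..real_of_int d} x * g x)"
    using Quotient_rel[OF Quotient_L2, of
        "\<lambda>x. indicator {real_of_int c..real_of_int d} x * f x"
        "\<lambda>x. indicator {real_of_int c..real_of_int d} x * g x"] f g
    by (auto simp: L2_restrict_def L2_rel_def)
  also have "\<dots> \<longleftrightarrow> (AE x in lborel. x \<in> {real_of_int c..real_of_int d} \<longrightarrow> f x = g x)"
    by (intro AE_cong) (auto simp: indicator_def)
  finally show ?thesis .
qed

text \<open>The convention \<open>0 ^ 0 = 1\<close> must not interfere at the knots when the exponent is \<open>0\<close>.\<close>

definition trunc_power :: "nat \<Rightarrow> real \<Rightarrow> real" where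
  "trunc_power n x = (if x > 0 then x ^ n else 0)"

definition bspline :: "nat \<Rightarrow> real \<Rightarrow> real" where
  "bspline m x =
    1 / fact m * (\<Sum>i=0..m. (- 1) ^ i * real (m choose i) * trunc_power (m - 1) (x - real i))"

definition dilate :: "(real \<Rightarrow> real) \<Rightarrow> nat \<Rightarrow> real \<Rightarrow> real \<Rightarrow> real" where
  "dilate f j \<kappa> x = 2 powr (real j / 2) * f (2 ^ j * x - \<kappa>)"

definition V_space :: "nat \<Rightarrow> int \<Rightarrow> int \<Rightarrow> nat \<Rightarrow> L2 set" where
  "V_space m c d j =
    span {L2_restrict c d (dilate (bspline m) j (real_of_int k)) |k::int.
      2 ^ j * c - int m < k \<and> k < 2 ^ j * d}"

definition is_spline_wavelet :: "nat \<Rightarrow> nat \<Rightarrow> (real \<Rightarrow> real) \<Rightarrow> bool" where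
  "is_spline_wavelet m w \<psi> \<longleftrightarrow>
    (\<exists>x. \<psi> x \<noteq> 0) \<and>
    (\<exists>(N::int set) q. finite N \<and>
      (\<forall>x. \<psi> x = (\<Sum>n\<in>N. q n * bspline m (2 * x - real_of_int n)))) \<and>
    closure {x. \<psi> x \<noteq> 0} = {0..real w}"

definition W_space :: "nat \<Rightarrow> (real \<Rightarrow> real) \<Rightarrow> int \<Rightarrow> int \<Rightarrow> nat \<Rightarrow> L2 set" where
  "W_space w \<psi> c d j = (let z = (real w - 1) / 2 in
    span {L2_restrict c d (dilate \<psi> j (real_of_int k)) |k::int.
      2 ^ j * c - \<lfloor>z\<rfloor> \<le> k \<and> k < 2 ^ j * d - \<lfloor>z\<rfloor>})"

definition is_direct_sum :: "L2 set \<Rightarrow> L2 set \<Rightarrow> L2 set \<Rightarrow> bool" where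
  "is_direct_sum U A B \<longleftrightarrow> U = {a + b |a b. a \<in> A \<and> b \<in> B} \<and> A \<inter> B = {0}"

definition refined_wavelets ::
    "nat \<Rightarrow> (real \<Rightarrow> real) \<Rightarrow> int \<Rightarrow> int \<Rightarrow> nat \<Rightarrow> nat \<Rightarrow> L2 set" where
  "refined_wavelets w \<psi> c d j l =
    {L2_restrict c d (dilate \<psi> j \<kappa>) |\<kappa>::real.
      \<kappa> \<in> {2 ^ j * real_of_int c - real w <..< 2 ^ j * real_of_int d} \<and>
      (\<exists>p::int. \<kappa> = real_of_int p / 2 ^ l)}"

end

theory Submission
  imports Defs
begin

text \<open>
  Let real polynomials act on functions by letting the indeterminate \<open>X\<close> act as the translation
  \<open>x \<mapsto> x - 1\<close>. Then \<open>m! \<phi> = (1 - X)\<^sup>m \<cdot> x\<^sub>+\<^sup>m\<^sup>-\<^sup>1\<close>, and dilation by \<open>K\<close> turns the action of \<open>P(X)\<close>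
  on a truncated power into that of \<open>P(X\<^sup>K)\<close>. Since \<open>1 - X\<close> divides \<open>1 - X\<^sup>K\<close>, the wavelet is
  \<open>\<psi>(x) = (B \<cdot> \<phi>)(2\<^sup>l x)\<close> for a polynomial \<open>B\<close>, and \<open>supp \<psi> = [0,w]\<close> forces \<open>B(0) \<noteq> 0\<close> and \<open>m \<le> 2w\<close>.
  Hence on \<open>[c,d]\<close> each refined wavelet starting at the knot \<open>p / 2\<^sup>j\<^sup>+\<^sup>l\<close> is a nonzero multiple of the
  B-spline starting there plus B-splines starting further right. As B-splines starting at or right
  of \<open>d\<close> vanish, this system is triangular and can be solved for the B-splines.
\<close>

section \<open>Polynomials acting by translation\<close>

definition translate_act :: "real poly \<Rightarrow> (real \<Rightarrow> real) \<Rightarrow> real \<Rightarrow> real" where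
  "translate_act P f x = (\<Sum>i\<le>degree P. coeff P i * f (x - real i))"

lemma translate_act_eq_sum:
  assumes "degree P \<le> n"
  shows "translate_act P f x = (\<Sum>i\<le>n. coeff P i * f (x - real i))"
  unfolding translate_act_def
  by (rule sum.mono_neutral_left) (use assms in \<open>auto simp: coeff_eq_0\<close>)

lemma translate_act_0 [simp]: "translate_act 0 f x = 0"
  by (simp add: translate_act_def)

lemma translate_act_add: "translate_act (P + Q) f x = translate_act P f x + translate_act Q f x"
proof -
  define n where "n = max (degree P) (degree Q)"
  have "degree P \<le> n" "degree Q \<le> n" "degree (P + Q) \<le> n"
    by (auto simp: n_def degree_add_le)
  then show ?thesis
    by (simp add: translate_act_eq_sum[of _ n] sum.distrib distrib_right)
qed

lemma translate_act_smult: "translate_act (smult a P) f x = a * translate_act P f x"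
  by (simp add: translate_act_eq_sum[of _ "degree P"] degree_smult_le sum_distrib_left mult.assoc)

lemma translate_act_pCons: "translate_act (pCons a P) f x = a * f x + translate_act P f (x - 1)"
proof -
  have "translate_act (pCons a P) f x = (\<Sum>i\<le>Suc (degree P). coeff (pCons a P) i * f (x - real i))"
    by (rule translate_act_eq_sum) (simp add: degree_pCons_le)
  also have "\<dots> = a * f x + (\<Sum>i\<le>degree P. coeff P i * f (x - 1 - real i))"
    by (subst sum.atMost_Suc_shift) (simp add: algebra_simps)
  finally show ?thesis by (simp add: translate_act_def)
qed

lemma translate_act_sum:
  "translate_act (\<Sum>a\<in>S. P a) f x = (\<Sum>a\<in>S. translate_act (P a) f x)"
  by (induction S rule: infinite_finite_induct) (simp_all add: translate_act_add)

lemma translate_act_monom: "translate_act (monom a k) f x = a * f (x - real k)"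
  by (induction k arbitrary: x)
    (simp_all add: monom_0 monom_Suc translate_act_pCons algebra_simps)

lemma translate_act_scale_fun: "translate_act P (\<lambda>x. a * f x) x = a * translate_act P f x"
  by (simp add: translate_act_def sum_distrib_left mult_ac)

text \<open>This makes the action multiplicative, so that factorisations of polynomials become
  identities between splines.\<close>

lemma translate_act_mult: "translate_act (P * Q) f x = translate_act P (translate_act Q f) x"
  by (induction P arbitrary: x)
    (simp_all add: translate_act_pCons translate_act_add translate_act_smult)

lemma translate_act_pcompose_monom:
  "translate_act (pcompose P (monom 1 k)) f x = (\<Sum>i\<le>degree P. coeff P i * f (x - real (k * i)))"
proof -
  have "translate_act (pcompose P (monom 1 k)) f x
      = translate_act P (\<lambda>y. f (x + real k * y)) 0"
  proof (induction P arbitrary: x)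
    case (pCons a P)
    have shift: "translate_act P (\<lambda>y. f (x - real k + real k * y)) 0
        = translate_act P (\<lambda>y. f (x + real k * y)) (- 1)"
      by (simp add: translate_act_def algebra_simps)
    show ?case
      by (simp add: pcompose_pCons translate_act_pCons translate_act_add translate_act_mult
          translate_act_monom pCons.IH shift)
  qed simp
  then show ?thesis
    by (simp add: translate_act_def)
qed

text \<open>Each factor 1 - X takes p(x) to p(x) - p(x - 1), where the leading terms cancel.\<close>

lemma translate_act_difference_power_poly:
  assumes "degree p < m"
  shows "translate_act ([:1, -1:] ^ m) (poly p) x = 0"
  using assms
proof (induction m arbitrary: p)
  case (Suc m)
  let ?q = "p - pcompose p [:-1, 1:]"
  have "translate_act [:1, -1:] (poly p) = poly ?q"
    by (rule ext) (simp add: translate_act_pCons poly_pcompose)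
  then have step: "translate_act ([:1, -1:] ^ Suc m) (poly p) x = translate_act ([:1, -1:] ^ m) (poly ?q) x"
    by (simp only: power_Suc2 translate_act_mult)
  show ?case
  \<comment> \<open>For constant \<open>p\<close> the difference is 0, whose degree is 0 by
    convention, so there is no strict drop.\<close>
  proof (cases "?q = 0")
    case True
    then show ?thesis unfolding step by (simp add: translate_act_def)
  next
    case False
    have "degree ?q < degree p"
    proof (rule degree_less_if_less_eqI)
      show "degree ?q \<le> degree p"
        by (rule degree_diff_le) (simp_all add: degree_pcompose)
      have "lead_coeff (pcompose p [:-1, 1:]) = lead_coeff p"
        by (subst lead_coeff_comp) simp_all
      then show "coeff ?q (degree p) = 0"
        by (simp add: degree_pcompose)
    qed (rule False)
    then show ?thesis unfolding step using Suc by simp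
  qed
qed simp

section \<open>Truncated powers near both ends of the support\<close>

lemma trunc_power_scale:
  assumes "a > 0"
  shows "trunc_power n (a * x) = a ^ n * trunc_power n x"
  using assms by (simp add: trunc_power_def power_mult_distrib zero_less_mult_iff)

lemma translate_act_trunc_power_nonpos:
  assumes "x \<le> 0"
  shows "translate_act P (trunc_power n) x = 0"
  unfolding translate_act_def
  by (rule sum.neutral) (use assms in \<open>auto simp: trunc_power_def\<close>)

text \<open>Up to 1 all shifted truncated powers still vanish. This detects where a spline
  begins.\<close>

lemma translate_act_trunc_power_first:
  assumes "x \<le> 1"
  shows "translate_act P (trunc_power n) x = coeff P 0 * trunc_power n x"
proof (cases P)
  case (pCons a P')
  then show ?thesis
    using assms translate_act_trunc_power_nonpos[of "x - 1" P' n]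
    by (simp add: translate_act_pCons)
qed

lemma translate_act_power_eq_0:
  assumes "[:1, -1:] ^ m dvd P" and "n < m"
  shows "translate_act P (\<lambda>y. y ^ n) x = 0"
proof -
  obtain A where A: "P = A * [:1, -1:] ^ m"
    using assms(1) by (metis dvdE mult.commute)
  have "(\<lambda>y::real. y ^ n) = poly (monom 1 n)"
    by (simp add: fun_eq_iff poly_monom)
  moreover have "degree (monom (1::real) n) < m"
    using assms(2) by (simp add: degree_monom_eq)
  ultimately have "translate_act ([:1, -1:] ^ m) (\<lambda>y. y ^ n) = (\<lambda>_. 0)"
    by (simp only: fun_eq_iff translate_act_difference_power_poly simp_thms)
  then show ?thesis
    by (simp add: A translate_act_mult) (simp add: translate_act_def)
qed

text \<open>Here all truncated powers but the last agree with full powers. The sum of full powers is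
  0, so minus its last term remains. This detects where a spline ends.\<close>

lemma translate_act_trunc_power_last:
  assumes "[:1, -1:] ^ m dvd P" and "n < m" and "real (degree P) - 1 < x" and "x < real (degree P)"
  shows "translate_act P (trunc_power n) x = - lead_coeff P * (x - real (degree P)) ^ n"
proof -
  have split: "{..degree P} = insert (degree P) {..<degree P}" by auto
  have "translate_act P (trunc_power n) x = (\<Sum>i<degree P. coeff P i * (x - real i) ^ n)"
    unfolding translate_act_def split using assms(3,4) by (auto simp: trunc_power_def intro!: sum.cong)
  moreover have "translate_act P (\<lambda>y. y ^ n) x
      = lead_coeff P * (x - real (degree P)) ^ n + (\<Sum>i<degree P. coeff P i * (x - real i) ^ n)"
    unfolding translate_act_def split by simp
  ultimately show ?thesis
    using translate_act_power_eq_0[OF assms(1,2), of x] by simp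
qed

lemma translate_act_trunc_power_right:
  assumes "[:1, -1:] ^ m dvd P" and "n < m" and "x > real (degree P)"
  shows "translate_act P (trunc_power n) x = 0"
proof -
  have "translate_act P (trunc_power n) x = translate_act P (\<lambda>y. y ^ n) x"
    unfolding translate_act_def using assms(3) by (auto simp: trunc_power_def intro!: sum.cong)
  then show ?thesis using translate_act_power_eq_0[OF assms(1,2)] by simp
qed

section \<open>B-splines as images of truncated powers\<close>

lemma bspline_eq_translate_act:
  "bspline m x = 1 / fact m * translate_act ([:1, -1:] ^ m) (trunc_power (m - 1)) x"
  by (simp add: bspline_def translate_act_def coeff_linear_poly_power atMost_atLeast0 mult_ac)

lemma translate_act_bspline:
  "translate_act A (bspline m) x =
    1 / fact m * translate_act (A * [:1, -1:] ^ m) (trunc_power (m - 1)) x"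
proof -
  have "bspline m = (\<lambda>y. 1 / fact m * translate_act ([:1, -1:] ^ m) (trunc_power (m - 1)) y)"
    by (rule ext) (rule bspline_eq_translate_act)
  then show ?thesis
    by (simp only: translate_act_scale_fun translate_act_mult)
qed

lemma bspline_left:
  assumes "x \<le> 0"
  shows "bspline m x = 0"
  using assms by (simp add: bspline_eq_translate_act translate_act_trunc_power_nonpos)

text \<open>At \<open>x = m\<close> itself this fails for \<open>m = 1\<close>.\<close>

lemma bspline_right:
  assumes "m \<ge> 1" and "x > real m"
  shows "bspline m x = 0"
  using assms translate_act_trunc_power_right[of m "[:1, -1:] ^ m" "m - 1" x]
  by (simp add: bspline_eq_translate_act)

section \<open>The wavelet as a combination of B-splines\<close>

text \<open>A combination of half-scale B-splines really begins at its least index with nonzero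
  coefficient and ends at its last knot. Comparison with [0,w] puts the first index at 0 and bounds
  the length, which is at least \<open>m\<close> half-units.\<close>

lemma spline_wavelet_translate_act:
  assumes "m \<ge> 1" and "is_spline_wavelet m w \<psi>"
  obtains A where "coeff A 0 \<noteq> 0" and "m \<le> 2 * w"
    and "\<And>x. \<psi> x = translate_act A (bspline m) (2 * x)"
proof -
  from assms(2) obtain N q x0 where x0: "\<psi> x0 \<noteq> 0" and fin: "finite N"
    and \<psi>: "\<And>x. \<psi> x = (\<Sum>n\<in>N. q n * bspline m (2 * x - real_of_int n))"
    and supp: "closure {x. \<psi> x \<noteq> 0} = {0..real w}"
    unfolding is_spline_wavelet_def by blast
  have pos: "0 \<le> x \<and> x \<le> real w" if "\<psi> x \<noteq> 0" for x
    using closure_subset[of "{x. \<psi> x \<noteq> 0}"] that supp by auto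
  \<comment> \<open>Zero coefficients are dropped so that the minimum \<open>n0\<close> has a
    nonzero one.\<close>
  define N' where "N' = {n \<in> N. q n \<noteq> 0}"
  have fin': "finite N'" using fin by (simp add: N'_def)
  have \<psi>': "\<psi> x = (\<Sum>n\<in>N'. q n * bspline m (2 * x - real_of_int n))" for x
    unfolding \<psi> N'_def by (rule sum.mono_neutral_right) (use fin in auto)
  have "N' \<noteq> {}" using x0 \<psi>'[of x0] by auto
  define n0 where "n0 = Min N'"
  have n0: "n0 \<in> N'" "\<And>n. n \<in> N' \<Longrightarrow> n0 \<le> n"
    using fin' \<open>N' \<noteq> {}\<close> by (auto simp: n0_def)
  define A where "A = (\<Sum>n\<in>N'. monom (q n) (nat (n - n0)))"
  have "coeff A 0 = (\<Sum>n\<in>N'. if n = n0 then q n else 0)"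
    unfolding A_def coeff_sum by (rule sum.cong) (use n0(2) in force)+
  also have "\<dots> = q n0" using n0 fin' by simp
  finally have A0: "coeff A 0 \<noteq> 0" using n0(1) by (simp add: N'_def)
  have \<psi>A: "\<psi> x = translate_act A (bspline m) (2 * x - real_of_int n0)" for x
    unfolding A_def translate_act_sum \<psi>' translate_act_monom
    by (rule sum.cong) (use n0(2) in \<open>auto simp: algebra_simps\<close>)
  define Q where "Q = A * [:1, -1:] ^ m"
  have Q_dvd: "[:1, -1:] ^ m dvd Q" by (simp add: Q_def)
  have \<psi>Q: "\<psi> x = 1 / fact m * translate_act Q (trunc_power (m - 1)) (2 * x - real_of_int n0)" for x
    unfolding \<psi>A Q_def by (rule translate_act_bspline)
  have Q0: "coeff Q 0 \<noteq> 0" using A0 by (simp add: Q_def coeff_mult coeff_0_power)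
  have "n0 \<le> 0"
  proof -
    have "{x. \<psi> x \<noteq> 0} \<subseteq> {real_of_int n0 / 2..}"
      using translate_act_trunc_power_nonpos[of "2 * x - real_of_int n0" Q "m - 1" for x]
      by (force simp: \<psi>Q)
    then have "closure {x. \<psi> x \<noteq> 0} \<subseteq> {real_of_int n0 / 2..}"
      by (rule closure_minimal) simp
    then have "0 \<in> {real_of_int n0 / 2..}" unfolding supp by force
    then show ?thesis by simp
  qed
  moreover have "n0 \<ge> 0"
  proof -
    \<comment> \<open>The test point lies in the middle of the first knot interval, where only the
      constant coefficient of \<open>Q\<close> contributes.\<close>
    have "2 * (real_of_int n0 / 2 + 1 / 4) - real_of_int n0 = 1 / 2" by simp
    then have "\<psi> (real_of_int n0 / 2 + 1 / 4) \<noteq> 0"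
      using Q0 unfolding \<psi>Q by (simp only: translate_act_trunc_power_first) (simp add: trunc_power_def)
    then show ?thesis using pos by fastforce
  qed
  ultimately have "n0 = 0" by simp
  have deg: "degree Q = degree A + m"
  proof -
    have "A \<noteq> 0" using A0 by auto
    then show ?thesis unfolding Q_def by (subst degree_mult_eq) auto
  qed
  \<comment> \<open>Likewise the middle of the last knot interval; integrality later absorbs the
    1/2.\<close>
  have "2 * (real (degree Q) / 2 - 1 / 4) - real_of_int n0 = real (degree Q) - 1 / 2"
    by (simp add: \<open>n0 = 0\<close>)
  moreover have "translate_act Q (trunc_power (m - 1)) (real (degree Q) - 1 / 2) \<noteq> 0"
    using Q0 assms(1) by (subst translate_act_trunc_power_last[OF Q_dvd]) auto
  ultimately have "\<psi> (real (degree Q) / 2 - 1 / 4) \<noteq> 0"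
    unfolding \<psi>Q by simp
  then have "real (degree Q) - 1 / 2 \<le> 2 * real w"
    using pos by fastforce
  then have "degree Q \<le> 2 * w" by linarith
  then have "m \<le> 2 * w" using deg by simp
  with A0 \<psi>A \<open>n0 = 0\<close> show ?thesis by (intro that[of A]) simp_all
qed

lemma pcompose_power: "pcompose (P ^ n) Q = pcompose P Q ^ n"
  for P Q :: "'a::comm_semiring_1 poly"
  by (induction n) (simp_all add: pcompose_mult pcompose_1)

text \<open>The K-scale refinement relation: 1 - X^K is 1 - X times the geometric sum G = 1 + X +
  ... + X^(K-1), and C is a multiple of G^m.\<close>

lemma bspline_refine:
  assumes "K \<ge> 1"
  obtains C where "coeff C 0 \<noteq> 0"
    and "\<And>x. translate_act A (bspline m) x = translate_act (pcompose A (monom 1 K) * C) (bspline m) (real K * x)"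
proof -
  have "poly (1 - monom 1 K) (1::real) = 0" by (simp add: poly_monom)
  then have "[:-1, 1:] dvd 1 - monom (1::real) K"
    by (simp only: poly_eq_0_iff_dvd)
  then obtain H where H: "1 - monom (1::real) K = [:-1, 1:] * H" ..
  \<comment> \<open>The root at 1 yields the factor X - 1; the sign change makes it 1 - X.\<close>
  define G where "G = - H"
  have G: "1 - monom (1::real) K = [:1, -1:] * G" unfolding H G_def by simp
  have "poly (1 - monom (1::real) K) 0 = 1" using assms by (simp add: poly_monom)
  then have "coeff G 0 = 1" unfolding G by (simp add: poly_0_coeff_0)
  define r where "r = 1 / real K ^ (m - 1)"
  have r: "r \<noteq> 0" using assms by (simp add: r_def)
  let ?t = "trunc_power (m - 1)"
  \<comment> \<open>Homogeneity of degree \<open>m - 1\<close> is the source of the factor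
    \<open>r\<close>, and the shift by \<open>K * i\<close> that of X^K.\<close>
  have tK: "?t (x - real i) = r * ?t (real K * x - real (K * i))" for x i
    using assms trunc_power_scale[of "real K" "m - 1" "x - real i"]
    by (simp add: r_def right_diff_distrib)
  have "translate_act P ?t x = r * translate_act (pcompose P (monom 1 K)) ?t (real K * x)" for P x
    unfolding translate_act_pcompose_monom
    unfolding translate_act_def sum_distrib_left
    by (rule sum.cong) (rule refl, subst tK, rule mult.left_commute)
  moreover have "pcompose (A * [:1, -1:] ^ m) (monom 1 K) = pcompose A (monom 1 K) * G ^ m * [:1, -1:] ^ m"
  proof -
    have "pcompose [:1, -1:] (monom 1 K) = [:1, -1:] * G"
      unfolding G[symmetric] by (simp add: pcompose_pCons one_pCons)
    then have "pcompose ([:1, -1:] ^ m) (monom 1 K) = ([:1, -1:] * G) ^ m"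
      by (simp only: pcompose_power)
    then show ?thesis by (simp only: pcompose_mult power_mult_distrib mult_ac)
  qed
  ultimately have *: "translate_act (A * [:1, -1:] ^ m) ?t x
      = r * translate_act (pcompose A (monom 1 K) * G ^ m * [:1, -1:] ^ m) ?t (real K * x)" for x
    by metis
  have "translate_act A (bspline m) x
      = translate_act (pcompose A (monom 1 K) * smult r (G ^ m)) (bspline m) (real K * x)" for x
    unfolding translate_act_bspline mult_smult_right mult_smult_left translate_act_smult *
    by (rule refl)
  moreover have "coeff (smult r (G ^ m)) 0 \<noteq> 0"
    using r \<open>coeff G 0 = 1\<close> by (simp add: coeff_0_power)
  ultimately show ?thesis by (rule that[rotated])
qed

text \<open>The wavelet already has scale 2, so refining by \<open>2 ^ (l - 1)\<close> is enough.
  The bound on \<open>m\<close> will make the refined wavelets reach as far left as the B-splines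
  do.\<close>

lemma spline_wavelet_refine:
  assumes "m \<ge> 1" and "is_spline_wavelet m w \<psi>" and "l \<ge> 1"
  obtains B where "coeff B 0 \<noteq> 0" and "m \<le> 2 ^ l * w"
    and "\<And>x. \<psi> x = translate_act B (bspline m) (2 ^ l * x)"
proof -
  obtain A where A: "coeff A 0 \<noteq> 0" "m \<le> 2 * w" "\<And>x. \<psi> x = translate_act A (bspline m) (2 * x)"
    by (rule spline_wavelet_translate_act[OF assms(1,2)]) (rule that)
  define K :: nat where "K = 2 ^ (l - 1)"
  have K: "K \<ge> 1" "2 ^ l = 2 * K" using assms(3) by (cases l; simp add: K_def)+
  obtain C where C: "coeff C 0 \<noteq> 0"
      "\<And>x. translate_act A (bspline m) x = translate_act (pcompose A (monom 1 K) * C) (bspline m) (real K * x)"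
    by (rule bspline_refine[OF K(1)]) (rule that)
  show ?thesis
  proof
    have "poly (pcompose A (monom 1 K)) 0 = poly A 0"
      using K by (simp add: poly_pcompose poly_monom power_0_left)
    then show "coeff (pcompose A (monom 1 K) * C) 0 \<noteq> 0"
      using A(1) C(1) by (simp add: coeff_mult poly_0_coeff_0)
    have "2 * w \<le> 2 ^ l * w" using K by simp
    with A(2) show "m \<le> 2 ^ l * w" by (rule le_trans)
    have "(2::real) ^ l = real K * 2"
      using K(2) by (metis mult.commute of_nat_mult of_nat_numeral of_nat_power)
    then show "\<psi> x = translate_act (pcompose A (monom 1 K) * C) (bspline m) (2 ^ l * x)" for x
      by (simp add: A(3) C(2) mult.assoc)
  qed
qed

section \<open>Restriction to the interval\<close>

text \<open>As \<open>L2\<close> is a partial quotient, the linearity rules for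
  \<open>L2_restrict\<close> carry this side condition.\<close>

definition L2_on :: "int \<Rightarrow> int \<Rightarrow> (real \<Rightarrow> real) \<Rightarrow> bool" where
  "L2_on c d f \<longleftrightarrow> square_integrable (\<lambda>x. indicator {real_of_int c..real_of_int d} x * f x)"

lemma L2_on_zero: "L2_on c d (\<lambda>x. 0)"
  by (simp add: L2_on_def square_integrable_zero)

lemma L2_on_add: "L2_on c d f \<Longrightarrow> L2_on c d g \<Longrightarrow> L2_on c d (\<lambda>x. f x + g x)"
  unfolding L2_on_def distrib_left by (rule square_integrable_add)

lemma L2_on_scale: "L2_on c d f \<Longrightarrow> L2_on c d (\<lambda>x. r * f x)"
  unfolding L2_on_def using square_integrable_scale by (simp add: mult.left_commute)

lemma L2_on_sum:
  assumes "\<And>a. a \<in> S \<Longrightarrow> L2_on c d (f a)"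
  shows "L2_on c d (\<lambda>x. \<Sum>a\<in>S. f a x)"
  using assms
  by (induction S rule: infinite_finite_induct) (simp_all add: L2_on_zero L2_on_add)

lemma L2_restrict_zero: "L2_restrict c d (\<lambda>x. 0) = 0"
  by (simp add: L2_restrict_def zero_L2_def)

lemma L2_restrict_add:
  assumes "L2_on c d f" and "L2_on c d g"
  shows "L2_restrict c d (\<lambda>x. f x + g x) = L2_restrict c d f + L2_restrict c d g"
  using assms
  by (simp add: L2_restrict_def L2_on_def plus_L2.abs_eq L2_rel_def distrib_left)

lemma L2_restrict_scale:
  assumes "L2_on c d f"
  shows "L2_restrict c d (\<lambda>x. r * f x) = r *\<^sub>R L2_restrict c d f"
  using assms
  by (simp add: L2_restrict_def L2_on_def scaleR_L2.abs_eq L2_rel_def mult.left_commute)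

lemma L2_restrict_sum:
  assumes "\<And>a. a \<in> S \<Longrightarrow> L2_on c d (f a)"
  shows "L2_restrict c d (\<lambda>x. \<Sum>a\<in>S. f a x) = (\<Sum>a\<in>S. L2_restrict c d (f a))"
  using assms
  by (induction S rule: infinite_finite_induct)
    (simp_all add: L2_restrict_zero L2_restrict_add L2_on_sum)

text \<open>The full power dominates the truncated one and is continuous on the compact
  interval.\<close>

lemma L2_on_trunc_power: "L2_on c d (\<lambda>x. trunc_power n (a * x - b))"
proof -
  let ?I = "{real_of_int c..real_of_int d}"
  have "continuous_on ?I (\<lambda>x. ((a * x - b) ^ n)\<^sup>2)"
    by (intro continuous_intros)
  then have int: "integrable lborel (\<lambda>x. indicator ?I x *\<^sub>R ((a * x - b) ^ n)\<^sup>2)"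
    using borel_integrable_atLeastAtMost' unfolding set_integrable_def by blast
  have [measurable]: "(\<lambda>x. trunc_power n (a * x - b)) \<in> borel_measurable borel"
    unfolding trunc_power_def by measurable
  have "integrable lborel (\<lambda>x. (indicator ?I x * trunc_power n (a * x - b))\<^sup>2)"
    by (rule Bochner_Integration.integrable_bound[OF int])
      (auto simp: indicator_def trunc_power_def)
  then show ?thesis
    by (simp add: L2_on_def square_integrable_def)
qed

lemma L2_on_dilate_bspline: "L2_on c d (dilate (bspline m) j \<kappa>)"
proof -
  have "L2_on c d (\<lambda>x. trunc_power (m - 1) (2 ^ j * x - \<kappa> - real i))" for i
    using L2_on_trunc_power[of c d "m - 1" "2 ^ j" "\<kappa> + real i"] by (simp add: algebra_simps)
  then show ?thesis
    unfolding dilate_def bspline_def by (intro L2_on_scale L2_on_sum)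
qed

lemma L2_restrict_dilate_bspline_eq_0:
  assumes "m \<ge> 1" and "k \<le> 2 ^ j * c - int m \<or> 2 ^ j * d \<le> k"
  shows "L2_restrict c d (dilate (bspline m) j (real_of_int k)) = 0"
proof -
  \<comment> \<open>For \<open>m = 1\<close> and \<open>k = 2 ^ j * c - 1\<close> the B-spline is
    nonzero at \<open>c\<close>, so this point is excluded as a null set.\<close>
  have "AE x in lborel. x \<noteq> real_of_int c"
    by (rule AE_lborel_singleton)
  then have "AE x in lborel. x \<in> {real_of_int c..real_of_int d} \<longrightarrow>
      dilate (bspline m) j (real_of_int k) x = 0"
  proof eventually_elim
    case (elim x)
    show ?case
    proof
      assume x: "x \<in> {real_of_int c..real_of_int d}"
      from assms(2) show "dilate (bspline m) j (real_of_int k) x = 0"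
      proof
        assume "k \<le> 2 ^ j * c - int m"
        then have "real_of_int k \<le> real_of_int (2 ^ j * c - int m)" by (simp only: of_int_le_iff)
        then have "real_of_int k \<le> 2 ^ j * real_of_int c - real m" by simp
        moreover have "2 ^ j * real_of_int c < 2 ^ j * x" using elim x by simp
        ultimately have "real m < 2 ^ j * x - real_of_int k" by linarith
        with assms(1) show ?thesis by (simp add: dilate_def bspline_right)
      next
        assume "2 ^ j * d \<le> k"
        then have "real_of_int (2 ^ j * d) \<le> real_of_int k" by (simp only: of_int_le_iff)
        then have "2 ^ j * real_of_int d \<le> real_of_int k" by simp
        moreover have "2 ^ j * x \<le> 2 ^ j * real_of_int d" using x by simp
        ultimately have "2 ^ j * x - real_of_int k \<le> 0" by linarith
        then show ?thesis by (simp add: dilate_def bspline_left)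
      qed
    qed
  qed
  then show ?thesis
    using L2_restrict_eq_iff[of c d "dilate (bspline m) j (real_of_int k)" "\<lambda>x. 0"]
      L2_on_dilate_bspline[of c d m j "real_of_int k"] L2_on_zero[of c d]
    by (simp add: L2_on_def L2_restrict_zero)
qed

lemma L2_restrict_dilate_translate_act:
  assumes "\<And>x. \<psi> x = translate_act B (bspline m) (2 ^ l * x)"
  shows "L2_restrict c d (dilate \<psi> j (real_of_int p / 2 ^ l)) =
    (\<Sum>i\<le>degree B. (2 powr (real j / 2) / 2 powr (real (j + l) / 2) * coeff B i) *\<^sub>R
      L2_restrict c d (dilate (bspline m) (j + l) (real_of_int (p + int i))))"
proof -
  \<comment> \<open>The ratio of the normalising factors at levels \<open>j\<close> and
    \<open>j + l\<close>.\<close>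
  let ?s = "2 powr (real j / 2) / 2 powr (real (j + l) / 2)"
  have "dilate \<psi> j (real_of_int p / 2 ^ l) x = (\<Sum>i\<le>degree B. (?s * coeff B i) *
      dilate (bspline m) (j + l) (real_of_int (p + int i)) x)" for x
  proof -
    have "2 ^ l * (2 ^ j * x - real_of_int p / 2 ^ l) - real i
        = 2 ^ (j + l) * x - real_of_int (p + int i)" for i
      by (simp add: field_simps power_add)
    then have "dilate \<psi> j (real_of_int p / 2 ^ l) x = (\<Sum>i\<le>degree B. 2 powr (real j / 2) *
        (coeff B i * bspline m (2 ^ (j + l) * x - real_of_int (p + int i))))"
      by (simp only: dilate_def assms translate_act_def sum_distrib_left)
    also have "\<dots> = (\<Sum>i\<le>degree B. (?s * coeff B i) *
      dilate (bspline m) (j + l) (real_of_int (p + int i)) x)"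
      by (rule sum.cong) (simp_all add: dilate_def)
    finally show ?thesis .
  qed
  then have "dilate \<psi> j (real_of_int p / 2 ^ l) = (\<lambda>x. \<Sum>i\<le>degree B. (?s * coeff B i) *
      dilate (bspline m) (j + l) (real_of_int (p + int i)) x)"
    by (rule ext)
  then show ?thesis
    by (simp only: L2_restrict_sum L2_restrict_scale L2_on_scale L2_on_dilate_bspline)
qed

section \<open>Solving the triangular system\<close>

text \<open>Back substitution from the right end \<open>b\<close>. Solving for \<open>e k\<close>
  uses only rows from \<open>k\<close> on; this lower bound later keeps the rows among the refined
  wavelets.\<close>

lemma triangular_span:
  fixes e :: "int \<Rightarrow> 'a::real_vector"
  assumes "a 0 \<noteq> 0" and e0: "\<And>k. k \<ge> b \<Longrightarrow> e k = 0"
  shows "e k \<in> span {(\<Sum>i\<le>n. a i *\<^sub>R e (p + int i)) |p. k \<le> p \<and> p < b}"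
proof (induction "nat (b - k)" arbitrary: k rule: less_induct)
  case less
  let ?\<Psi> = "\<lambda>p. \<Sum>i\<le>n. a i *\<^sub>R e (p + int i)"
  let ?S = "span {?\<Psi> p |p. k \<le> p \<and> p < b}"
  show ?case
  proof (cases "k < b")
    case False
    then show ?thesis using e0 by (simp add: span_zero)
  next
    case True
    \<comment> \<open>Even when \<open>k + int i\<close> exceeds \<open>b\<close> the measure drops,
      because \<open>k < b\<close>.\<close>
    have "e (k + int i) \<in> ?S" if "i \<ge> 1" for i
    proof -
      have "e (k + int i) \<in> span {?\<Psi> p |p. k + int i \<le> p \<and> p < b}"
        using that True by (intro less) auto
      moreover have "span {?\<Psi> p |p. k + int i \<le> p \<and> p < b} \<subseteq> ?S"
        by (rule span_mono) force
      ultimately show ?thesis by blast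
    qed
    then have "(\<Sum>i=1..n. a i *\<^sub>R e (k + int i)) \<in> ?S"
      by (intro span_sum span_scale) auto
    moreover have "?\<Psi> k \<in> ?S"
      using True by (intro span_base) auto
    moreover have "?\<Psi> k = a 0 *\<^sub>R e k + (\<Sum>i=1..n. a i *\<^sub>R e (k + int i))"
      by (simp add: atMost_atLeast0 sum.atLeast_Suc_atMost)
    ultimately have "a 0 *\<^sub>R e k \<in> ?S"
      by (simp only: span_add_eq2)
    then have "(1 / a 0) *\<^sub>R a 0 *\<^sub>R e k \<in> ?S" by (rule span_scale)
    then show ?thesis using assms(1) by simp
  qed
qed

theorem theorem1:
  fixes m w :: nat and c d :: int and \<psi> :: "real \<Rightarrow> real" and j l :: nat
  assumes "m \<ge> 1" and "w \<ge> 1" and "c < d"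
    and "d - c \<ge> max (int m) (int w)"
    and "is_spline_wavelet m w \<psi>"
    and "\<And>i. is_direct_sum (V_space m c d (Suc i)) (V_space m c d i) (W_space w \<psi> c d i)"
    and "\<And>i. int (dim (W_space w \<psi> c d i)) = (d - c) * 2 ^ i"
    and "l \<ge> 1"
  shows "span (refined_wavelets w \<psi> c d j l) = V_space m c d (j + l)"
proof -
  obtain B where B: "coeff B 0 \<noteq> 0" "m \<le> 2 ^ l * w"
    "\<And>x. \<psi> x = translate_act B (bspline m) (2 ^ l * x)"
    by (rule spline_wavelet_refine[OF assms(1,5,8)]) (rule that)
  let ?N = "2 ^ (j + l) :: int"
  define e where "e k = L2_restrict c d (dilate (bspline m) (j + l) (real_of_int k))" for k
  define a where "a i = 2 powr (real j / 2) / 2 powr (real (j + l) / 2) * coeff B i" for i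
  define \<Psi> where "\<Psi> p = L2_restrict c d (dilate \<psi> j (real_of_int p / 2 ^ l))" for p
  have \<Psi>_eq: "\<Psi> p = (\<Sum>i\<le>degree B. a i *\<^sub>R e (p + int i))" for p
    unfolding \<Psi>_def a_def e_def by (rule L2_restrict_dilate_translate_act) (rule B(3))
  have e0: "e k = 0" if "k \<le> ?N * c - int m \<or> ?N * d \<le> k" for k
    unfolding e_def using assms(1) that by (rule L2_restrict_dilate_bspline_eq_0)
  have V: "V_space m c d (j + l) = span {e k |k. ?N * c - int m < k \<and> k < ?N * d}"
    by (simp add: V_space_def e_def)
  \<comment> \<open>Multiplying the translation parameter by \<open>2 ^ l\<close> turns the bounds
    into bounds on the integer \<open>p\<close>.\<close>
  have W: "refined_wavelets w \<psi> c d j l = {\<Psi> p |p. ?N * c - 2 ^ l * int w < p \<and> p < ?N * d}"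
  proof -
    have "real_of_int p / 2 ^ l \<in> {2 ^ j * real_of_int c - real w <..< 2 ^ j * real_of_int d}
        \<longleftrightarrow> ?N * c - 2 ^ l * int w < p \<and> p < ?N * d" for p
    proof -
      have "real_of_int p / 2 ^ l \<in> {2 ^ j * real_of_int c - real w <..< 2 ^ j * real_of_int d}
        \<longleftrightarrow> real_of_int (?N * c - 2 ^ l * int w) < real_of_int p \<and> real_of_int p < real_of_int (?N * d)"
        by (simp add: field_simps power_add)
      then show ?thesis by (simp only: of_int_less_iff)
    qed
    then have "{\<Psi> p |p. ?N * c - 2 ^ l * int w < p \<and> p < ?N * d} = {\<Psi> p |p.
        real_of_int p / 2 ^ l \<in> {2 ^ j * real_of_int c - real w <..< 2 ^ j * real_of_int d}}"
      by (simp only:)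
    also have "\<dots> = refined_wavelets w \<psi> c d j l"
      unfolding refined_wavelets_def \<Psi>_def by fast
    finally show ?thesis ..
  qed
  show ?thesis
  proof
    \<comment> \<open>All \<open>k\<close> are covered, since wavelets near an end of the interval
      involve B-splines outside the index range of \<open>V_space\<close>; these restrict to
      0.\<close>
    have e_V: "e k \<in> V_space m c d (j + l)" for k
    proof (cases "?N * c - int m < k \<and> k < ?N * d")
      case True
      then show ?thesis unfolding V by (intro span_base) blast
    next
      case False
      then have "e k = 0" by (intro e0) auto
      then show ?thesis unfolding V by (simp add: span_zero)
    qed
    have "\<Psi> p \<in> V_space m c d (j + l)" for p
      unfolding \<Psi>_eq using e_V unfolding V by (intro span_sum span_scale)
    then show "span (refined_wavelets w \<psi> c d j l) \<subseteq> V_space m c d (j + l)"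
      unfolding W V by (intro span_minimal subspace_span) blast
    have "e k \<in> span (refined_wavelets w \<psi> c d j l)" if "?N * c - int m < k" for k
    proof -
      have "e k \<in> span {\<Psi> p |p. k \<le> p \<and> p < ?N * d}"
        unfolding \<Psi>_eq by (rule triangular_span) (use B(1) e0 in \<open>auto simp: a_def\<close>)
      \<comment> \<open>Hence a row \<open>p\<close> with \<open>k \<le> p\<close> satisfies the
        left bound for refined wavelets whenever \<open>k\<close> satisfies that for
        B-splines.\<close>
      moreover have "int m \<le> 2 ^ l * int w"
        using B(2) by (metis of_nat_le_iff of_nat_mult of_nat_numeral of_nat_power)
      then have "{\<Psi> p |p. k \<le> p \<and> p < ?N * d} \<subseteq> refined_wavelets w \<psi> c d j l"
        unfolding W using that by force
      ultimately show ?thesis by (rule span_mono[THEN subsetD, rotated])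
    qed
    then show "V_space m c d (j + l) \<subseteq> span (refined_wavelets w \<psi> c d j l)"
      unfolding V by (intro span_minimal subspace_span) blast
  qed
qed

end
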